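(* Let $q,n,m\ge 1$, $P\in\mathbb{R}^{q\times n}$, $A\in\mathbb{R}^{m\times n}$, $b\in\mathbb{R}^m$, and let $S=\{x\in\mathbb{R}^n\mid Ax\ge b\}$ be nonempty. Let $f\colon\mathbb{R}^q\to\mathbb{R}\cup\{-\infty,+\infty\}$ be quasi-concave and let $C\subseteq\mathbb{R}^q$ be a polyhedral convex pointed cone such that $f$ is $C$-monotone on the set $P[S]-C$ and $0^+P[S]\subseteq C$. Put $\mathcal{P}=P[S]+C$. Then the problem $$\min f(Px)\quad\text{s.t.}\quad Ax\ge b$$ has an optimal solution $x^*\in S$ such that $$f(Px^* )=\min_{y\in\operatorname{vert}\mathcal{P}} f(y).$$
   Context: $P[S]=\{Px\mid x\in S\}$; sums and differences of sets are Minkowski sums and differences. $0^+D=\{d\mid y+\lambda d\in D\ \forall y\in D,\ \lambda\ge 0\}$ is the recession cone of a nonempty convex polyhedron $D$. $\operatorname{vert}D$ is the set of vertices (extreme points) of $D$. A cone $C$ is pointed if $C\cap(-C)=\{0\}$. $f$ is quasi-concave if $\{y\mid f(y)\ge r\}$ is convex for every $r\in\mathbb{R}$. Write $x\le_C y$ if $y-x\in C$; $f$ is $C$-monotone on $D$ if $x,y\in D$, $x\le_C y$ imply $f(x)\le f(y)$. An optimal solution is a point $x^*\in S$ with $f(Px^* )\le f(Px)$ for all $x\in S$. *)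

theory Defs
  imports "HOL-Analysis.Analysis"
begin

text \<open>The order on \<open>real ^ 'm\<close> is componentwise.\<close>

definition feasible_set :: "real ^ 'n ^ 'm \<Rightarrow> real ^ 'm \<Rightarrow> (real ^ 'n) set" where
  "feasible_set A b = {x. A *v x \<ge> b}"

text \<open>On sets, \<open>-\<close> of the library is set difference and complement, so the Minkowski
  difference and the reflected set are written out explicitly.\<close>

definition minkowski_diff :: "'a::ab_group_add set \<Rightarrow> 'a set \<Rightarrow> 'a set" where
  "minkowski_diff X Y = {x - y | x y. x \<in> X \<and> y \<in> Y}"

definition pointed :: "'a::ab_group_add set \<Rightarrow> bool" where
  "pointed C \<longleftrightarrow> C \<inter> uminus ` C = {0}"

definition recession_cone :: "'a::real_vector set \<Rightarrow> 'a set" where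
  "recession_cone D = {d. \<forall>y\<in>D. \<forall>t\<ge>0. y + t *\<^sub>R d \<in> D}"

definition vert :: "'a::real_vector set \<Rightarrow> 'a set" where
  "vert D = {v. v extreme_point_of D}"

text \<open>The level \<open>r\<close> ranges over the reals only, although \<open>f\<close> is extended-real-valued.\<close>

definition quasi_concave :: "('a::real_vector \<Rightarrow> ereal) \<Rightarrow> bool" where
  "quasi_concave f \<longleftrightarrow> (\<forall>r::real. convex {y. f y \<ge> ereal r})"

definition cone_le :: "'a::ab_group_add set \<Rightarrow> 'a \<Rightarrow> 'a \<Rightarrow> bool" where
  "cone_le C x y \<longleftrightarrow> y - x \<in> C"

definition cone_monotone_on :: "'a::ab_group_add set \<Rightarrow> 'a set \<Rightarrow> ('a \<Rightarrow> ereal) \<Rightarrow> bool" where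
  "cone_monotone_on C D f \<longleftrightarrow> (\<forall>x\<in>D. \<forall>y\<in>D. cone_le C x y \<longrightarrow> f x \<le> f y)"

definition optimal_solution ::
    "(real ^ 'q \<Rightarrow> ereal) \<Rightarrow> real ^ 'n ^ 'q \<Rightarrow> (real ^ 'n) set \<Rightarrow> real ^ 'n \<Rightarrow> bool" where
  "optimal_solution f P S x \<longleftrightarrow> x \<in> S \<and> (\<forall>z\<in>S. f (P *v x) \<le> f (P *v z))"

text \<open>\<open>is_minimum f V m\<close>: the minimum of \<open>f\<close> over \<open>V\<close> is attained and equals \<open>m\<close>.\<close>

definition is_minimum :: "('a \<Rightarrow> ereal) \<Rightarrow> 'a set \<Rightarrow> ereal \<Rightarrow> bool" where
  "is_minimum f V m \<longleftrightarrow> (\<exists>y\<in>V. f y = m) \<and> (\<forall>y\<in>V. m \<le> f y)"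

end

theory Submission
  imports Defs
begin

text \<open>
  Every point of \<open>S\<close> is a convex combination of finitely many points of \<open>S\<close> plus a recession
  direction of \<open>S\<close>. Such directions are mapped into \<open>0\<^sup>+P[S] \<subseteq> C\<close>, so
  \<open>P[S] + C = conv F + C\<close> for a finite set \<open>F\<close>. A minimal such \<open>F\<close> consists of vertices because
  \<open>C\<close> is pointed, and these vertices lie in \<open>P[S]\<close>. Finally, for \<open>y = v + c \<in> P[S]\<close> with
  \<open>v\<close> a convex combination of vertices and \<open>c \<in> C\<close>, monotonicity gives \<open>f v \<le> f y\<close> and
  quasi-concavity gives a vertex whose value is at most \<open>f v\<close>.
\<close>

section \<open>Finite generation of polyhedra\<close>

text \<open>This is the ratio test of the simplex method. Only constraints in \<open>J\<close>
  decrease along \<open>d\<close>; \<open>r i\<close> is the time at which constraint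
  \<open>i\<close> becomes tight, and the smallest of these times violates none.\<close>

lemma first_blocking_time:
  fixes x d :: "real ^ 'n" and A :: "real ^ 'n ^ 'm"
  assumes x: "x \<in> feasible_set A b" and d: "\<not> 0 \<le> A *v d"
  obtains t i where "0 \<le> t" "x + t *\<^sub>R d \<in> feasible_set A b"
    "(A *v d) $ i < 0" "(A *v (x + t *\<^sub>R d)) $ i = b $ i"
proof -
  define J where "J = {i. (A *v d) $ i < 0}"
  define r where "r i = ((A *v x) $ i - b $ i) / - (A *v d) $ i" for i
  define t where "t = Min (r ` J)"
  have x': "b $ i \<le> (A *v x) $ i" for i
    using x by (simp add: feasible_set_def less_eq_vec_def)
  have J: "finite J" "J \<noteq> {}"
    using d by (auto simp: J_def less_eq_vec_def not_le)
  then have "t \<in> r ` J"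
    unfolding t_def by (intro Min_in) auto
  then obtain i where i: "i \<in> J" "t = r i"
    by blast
  have t0: "0 \<le> t"
    unfolding i(2) r_def using i(1) x'[of i] by (intro divide_nonneg_pos) (auto simp: J_def)
  have Ad: "(A *v (x + s *\<^sub>R d)) $ k = (A *v x) $ k + s * (A *v d) $ k" for s k
    by (simp add: matrix_vector_right_distrib matrix_vector_mult_scaleR)
  have "b $ k \<le> (A *v (x + t *\<^sub>R d)) $ k" for k
  proof (cases "k \<in> J")
    case True
    then have neg: "(A *v d) $ k < 0"
      by (simp add: J_def)
    have "t \<le> r k"
      unfolding t_def using J True by simp
    then show ?thesis
      unfolding Ad r_def using neg by (simp add: field_simps)
  next
    case False
    then have "0 \<le> t * (A *v d) $ k"
      using t0 by (simp add: J_def)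
    then show ?thesis
      unfolding Ad using x'[of k] by linarith
  qed
  then have "x + t *\<^sub>R d \<in> feasible_set A b"
    by (simp add: feasible_set_def less_eq_vec_def)
  moreover have "(A *v (x + t *\<^sub>R d)) $ i = b $ i"
    unfolding Ad i(2) r_def using i(1) by (simp add: J_def field_simps)
  ultimately show ?thesis
    using that t0 i(1) by (auto simp: J_def)
qed

lemma convex_feasible_set: "convex (feasible_set A b)"
proof (rule convexI)
  fix x y and u v :: real
  assume "x \<in> feasible_set A b" "y \<in> feasible_set A b" "0 \<le> u" "0 \<le> v" "u + v = 1"
  moreover from this have "u * b $ i + v * b $ i = b $ i" for i
    by (simp flip: distrib_right)
  ultimately show "u *\<^sub>R x + v *\<^sub>R y \<in> feasible_set A b"
    unfolding feasible_set_def less_eq_vec_def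
    by (simp add: matrix_vector_right_distrib matrix_vector_mult_scaleR)
      (metis add_mono mult_left_mono)
qed

text \<open>One feasible point is chosen for each set of active constraints that occurs, so
  \<open>F\<close> is finite because the row index has finitely many subsets. Induction on the
  number of inactive constraints then reaches every feasible point. No vertices of the feasible set
  are involved, so it may contain lines.\<close>

lemma feasible_set_decomposition:
  fixes A :: "real ^ 'n ^ 'm"
  obtains F where "finite F" "F \<subseteq> feasible_set A b"
    "feasible_set A b \<subseteq> convex hull F + {d. 0 \<le> A *v d}"
proof -
  let ?S = "feasible_set A b" and ?K = "{d. 0 \<le> A *v d}"
  define active where "active x = {i. (A *v x) $ i = b $ i}" for x
  define p where "p I = (SOME x. x \<in> ?S \<and> I \<subseteq> active x)" for I
  define F where "F = p ` active ` ?S"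
  have p: "p (active x) \<in> ?S \<and> active x \<subseteq> active (p (active x))" if "x \<in> ?S" for x
    unfolding p_def by (rule someI[of _ x]) (use that in simp)
  have "finite (active ` ?S)"
    by simp
  then have "finite F"
    by (simp add: F_def)
  have "F \<subseteq> ?S"
    using p by (auto simp: F_def)
  have "convex ?K"
    by (auto simp: convex_def less_eq_vec_def matrix_vector_right_distrib matrix_vector_mult_scaleR)
  then have conv: "convex (convex hull F + ?K)"
    by (intro convex_set_plus) simp_all
  \<comment> \<open>Moving from \<open>p I\<close> through \<open>x\<close> and beyond keeps the constraints in \<open>I\<close> active; either this
    ray stays in the feasible set, or another constraint becomes active.\<close>
  have "x \<in> convex hull F + ?K" if "x \<in> ?S" for x
    using that
  proof (induction "card (- active x)" arbitrary: x rule: less_induct)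
    case less
    let ?q = "p (active x)"
    have q: "?q \<in> convex hull F"
      using less.prems by (auto simp: F_def intro!: hull_inc)
    show ?case
    proof (cases "0 \<le> A *v (x - ?q)")
      case True
      then show ?thesis
        using set_plus_intro[OF q, of "x - ?q" ?K] by simp
    next
      case False
      then obtain t i where t: "0 \<le> t" and y: "x + t *\<^sub>R (x - ?q) \<in> ?S"
        and i: "(A *v (x - ?q)) $ i < 0" "(A *v (x + t *\<^sub>R (x - ?q))) $ i = b $ i"
        using first_blocking_time[OF less.prems] by metis
      let ?y = "x + t *\<^sub>R (x - ?q)"
      \<comment> \<open>Constraints active at \<open>x\<close> are also active at \<open>?q\<close>,
        hence constant on the line through both points. The blocking constraint \<open>i\<close>
        strictly decreases and is therefore a new one.\<close>
      have zero: "(A *v (x - ?q)) $ k = 0" if "k \<in> active x" for k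
        using that p[OF less.prems] by (auto simp: active_def matrix_vector_mult_diff_distrib)
      have "active x \<subseteq> active ?y"
        using zero
        by (auto simp: active_def matrix_vector_right_distrib matrix_vector_mult_scaleR)
      moreover have "i \<in> active ?y" "i \<notin> active x"
        using i zero[of i] by (auto simp: active_def)
      ultimately have "card (- active ?y) < card (- active x)"
        by (intro psubset_card_mono) auto
      then have y': "?y \<in> convex hull F + ?K"
        using less.hyps y by blast
      have q': "?q \<in> convex hull F + ?K"
        using set_plus_intro[OF q, of 0 ?K] by simp
      \<comment> \<open>The weights come from solving \<open>?y = x + t *\<^sub>R (x - ?q)\<close>
        for \<open>x\<close>, which lies between \<open>?q\<close> and \<open>?y\<close>.\<close>
      have "x = (t / (1 + t)) *\<^sub>R ?q + (1 / (1 + t)) *\<^sub>R ?y"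
      proof -
        have "(1 + t) *\<^sub>R ((t / (1 + t)) *\<^sub>R ?q + (1 / (1 + t)) *\<^sub>R ?y) = t *\<^sub>R ?q + ?y"
          using t by (simp add: scaleR_add_right)
        also have "\<dots> = (1 + t) *\<^sub>R x"
          by (simp add: algebra_simps)
        finally show ?thesis
          using t by (metis add_pos_nonneg less_numeral_extra(1,3) scaleR_left_imp_eq)
      qed
      moreover have "(t / (1 + t)) *\<^sub>R ?q + (1 / (1 + t)) *\<^sub>R ?y \<in> convex hull F + ?K"
        using t by (intro convexD[OF conv q' y']) (auto simp: field_simps)
      ultimately show ?thesis
        by simp
    qed
  qed
  then show ?thesis
    using that[OF \<open>finite F\<close> \<open>F \<subseteq> ?S\<close>] by blast
qed

section \<open>Vertices of a polytope plus a pointed cone\<close>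

text \<open>Here \<open>s\<close> is the total weight on \<open>H\<close>. Leaving \<open>h\<close>
  arbitrary when \<open>s = 0\<close> also covers empty \<open>H\<close>.\<close>

lemma convex_hull_insert_plus_coneE:
  fixes v :: "'a::real_vector"
  assumes "x \<in> convex hull (insert v H) + C" and "cone C"
  obtains s h c where "0 \<le> s" "c \<in> C" "s = 0 \<or> h \<in> convex hull H"
    "x = v + s *\<^sub>R (h - v) + c"
proof -
  obtain z c where z: "z \<in> convex hull (insert v H)" and c: "c \<in> C" and x: "x = z + c"
    using assms(1) by (auto elim: set_plus_elim)
  show ?thesis
  proof (cases "H = {}")
    case True
    then show ?thesis
      using that[of 0 c v] z c x by simp
  next
    case False
    then obtain u s h where "0 \<le> s" "u + s = 1" "h \<in> convex hull H"
      "z = u *\<^sub>R v + s *\<^sub>R h"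
      using z by (auto simp: convex_hull_insert)
    moreover from this have "u = 1 - s"
      by simp
    ultimately show ?thesis
      using that[of s c h] c x by (simp add: algebra_simps)
  qed
qed

lemma pointed_zero: "pointed C \<Longrightarrow> 0 \<in> C"
  unfolding pointed_def by blast

lemma pointedD: "x = 0" if "pointed C" "x \<in> C" "- x \<in> C"
proof -
  have "x \<in> uminus ` C"
    using that(3) by (rule rev_image_eqI) simp
  then show ?thesis
    using that(1,2) unfolding pointed_def by blast
qed

lemma convex_cone_scaleR_add:
  assumes "convex C" "cone C" "x \<in> C" "y \<in> C" "0 \<le> s" "0 \<le> t"
  shows "s *\<^sub>R x + t *\<^sub>R y \<in> C"
  using assms convex_cone[of C] by (simp add: mem_cone)

lemma convex_cone_plus_subset:
  assumes "convex C" "cone C"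
  shows "C + C \<subseteq> C"
  using convex_cone_scaleR_add[OF assms, of _ _ 1 1] by (auto elim!: set_plus_elim)

text \<open>If \<open>v\<close> lay strictly between \<open>a\<close> and \<open>b\<close>,
  expanding both around \<open>v\<close> would give \<open>sum0\<close>. With positive total weight
  on \<open>H\<close>, dividing by it puts \<open>v\<close> into \<open>convex hull H + C\<close>.
  With zero weight, a positive combination of \<open>c1\<close> and \<open>c2\<close> vanishes, and
  pointedness forces \<open>a = b\<close>.\<close>

lemma extreme_point_of_hull_insert_plus_cone:
  fixes v :: "'a::real_vector"
  assumes C: "convex C" "cone C" "pointed C"
    and v: "v \<notin> convex hull H + C"
  shows "v extreme_point_of (convex hull (insert v H) + C)"
proof -
  let ?D = "convex hull (insert v H) + C"
  have "0 \<in> C"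
    using C(3) by (rule pointed_zero)
  then have "v \<in> ?D"
    using set_plus_intro[of v "convex hull (insert v H)" 0 C] by (simp add: hull_inc)
  moreover have False if a: "a \<in> ?D" and b: "b \<in> ?D" and ab: "v \<in> open_segment a b" for a b
  proof -
    obtain t where t: "0 < t" "t < 1" "v = (1 - t) *\<^sub>R a + t *\<^sub>R b" and "a \<noteq> b"
      using ab by (auto simp: in_segment)
    obtain s1 h1 c1 where 1: "0 \<le> s1" "c1 \<in> C" "s1 = 0 \<or> h1 \<in> convex hull H"
      "a = v + s1 *\<^sub>R (h1 - v) + c1"
      using convex_hull_insert_plus_coneE[OF a C(2)] .
    obtain s2 h2 c2 where 2: "0 \<le> s2" "c2 \<in> C" "s2 = 0 \<or> h2 \<in> convex hull H"
      "b = v + s2 *\<^sub>R (h2 - v) + c2"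
      using convex_hull_insert_plus_coneE[OF b C(2)] .
    define \<alpha> where "\<alpha> = (1 - t) * s1"
    define \<beta> where "\<beta> = t * s2"
    define c where "c = (1 - t) *\<^sub>R c1 + t *\<^sub>R c2"
    have nonneg: "0 \<le> \<alpha>" "0 \<le> \<beta>"
      using t 1(1) 2(1) by (simp_all add: \<alpha>_def \<beta>_def)
    have "c \<in> C"
      unfolding c_def using t 1(2) 2(2) C by (intro convex_cone_scaleR_add) auto
    have "v = v + (\<alpha> *\<^sub>R (h1 - v) + \<beta> *\<^sub>R (h2 - v) + c)"
      unfolding \<alpha>_def \<beta>_def c_def by (subst t(3), subst 1(4), subst 2(4)) (simp add: algebra_simps)
    then have sum0: "\<alpha> *\<^sub>R (h1 - v) + \<beta> *\<^sub>R (h2 - v) + c = 0"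
      by simp
    show False
    proof (cases "\<alpha> + \<beta> = 0")
      case True
      then have "\<alpha> = 0" "\<beta> = 0"
        using nonneg by auto
      then have "s1 = 0" "s2 = 0" "c = 0"
        using t sum0 by (auto simp: \<alpha>_def \<beta>_def)
      then have eq: "(1 - t) *\<^sub>R c1 = - (t *\<^sub>R c2)"
        by (simp add: c_def eq_neg_iff_add_eq_0)
      have "(1 - t) *\<^sub>R c1 \<in> C" "t *\<^sub>R c2 \<in> C"
        using C(2) 1(2) 2(2) t by (auto simp: cone_def)
      then have "(1 - t) *\<^sub>R c1 \<in> C" "- ((1 - t) *\<^sub>R c1) \<in> C"
        using eq by simp_all
      then have "(1 - t) *\<^sub>R c1 = 0"
        by (rule pointedD[OF C(3)])
      then have "c1 = 0" "c2 = 0"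
        using t eq by simp_all
      then show False
        using \<open>a \<noteq> b\<close> 1(4) 2(4) \<open>s1 = 0\<close> \<open>s2 = 0\<close> by simp
    next
      case False
      then have pos: "0 < \<alpha> + \<beta>"
        using nonneg by auto
      let ?\<gamma> = "\<alpha> + \<beta>"
      define h where "h = (\<alpha> / ?\<gamma>) *\<^sub>R h1 + (\<beta> / ?\<gamma>) *\<^sub>R h2"
      have h: "h \<in> convex hull H"
      proof -
        \<comment> \<open>A point of weight zero need not lie in the hull, but then \<open>h\<close>
          equals the other point.\<close>
        consider "\<alpha> = 0" "h2 \<in> convex hull H" | "\<beta> = 0" "h1 \<in> convex hull H"
          | "h1 \<in> convex hull H" "h2 \<in> convex hull H"
          using 1(3) 2(3) False by (auto simp: \<alpha>_def \<beta>_def)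
        then show ?thesis
        proof cases
          case 3
          then show ?thesis
            unfolding h_def using nonneg pos
            by (intro convexD[OF convex_convex_hull]) (auto simp: add_divide_distrib[symmetric])
        qed (use False in \<open>auto simp: h_def\<close>)
      qed
      have "?\<gamma> *\<^sub>R (h + (1 / ?\<gamma>) *\<^sub>R c) = \<alpha> *\<^sub>R h1 + \<beta> *\<^sub>R h2 + c"
        using pos by (simp add: h_def scaleR_add_right)
      also have "\<dots> = ?\<gamma> *\<^sub>R v"
        using sum0 by (simp add: algebra_simps add_eq_0_iff)
      finally have "v = h + (1 / ?\<gamma>) *\<^sub>R c"
        using pos by (metis less_numeral_extra(3) scaleR_left_imp_eq)
      moreover have "(1 / ?\<gamma>) *\<^sub>R c \<in> C"
        using \<open>c \<in> C\<close> C(2) pos by (auto simp: cone_def)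
      ultimately show False
        using v h by (metis set_plus_intro)
    qed
  qed
  ultimately show ?thesis
    by (auto simp: extreme_point_of_def)
qed

text \<open>In an inclusion-minimal generating subset \<open>G\<close> of \<open>F\<close>, no
  \<open>v\<close> lies in \<open>convex hull (G - {v}) + C\<close>, since it could otherwise be
  dropped. Hence each \<open>v\<close> is extreme.\<close>

lemma convex_hull_plus_cone_vertices:
  fixes F :: "'a::real_vector set"
  assumes "finite F" and C: "convex C" "cone C" "pointed C"
  obtains G where "finite G" "G \<subseteq> vert (convex hull F + C)"
    "convex hull F + C = convex hull G + C"
proof -
  define \<G> where "\<G> = {G. G \<subseteq> F \<and> convex hull F + C = convex hull G + C}"
  have "finite \<G>"
    by (rule finite_subset[of _ "Pow F"]) (auto simp: \<G>_def \<open>finite F\<close>)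
  moreover have "F \<in> \<G>"
    by (simp add: \<G>_def)
  ultimately obtain G where G: "G \<in> \<G>" and min: "\<And>H. H \<in> \<G> \<Longrightarrow> H \<subseteq> G \<Longrightarrow> G = H"
    using finite_has_minimal[of \<G>] by blast
  have "v extreme_point_of (convex hull F + C)" if "v \<in> G" for v
  proof -
    define H where "H = G - {v}"
    have GH: "G = insert v H" "v \<notin> H"
      using that by (auto simp: H_def)
    have "v \<notin> convex hull H + C"
    proof
      \<comment> \<open>The convex set \<open>convex hull H + C\<close> then contains all of
        \<open>G\<close>, and it absorbs a further summand \<open>C\<close>.\<close>
      assume v: "v \<in> convex hull H + C"
      have "0 \<in> C"
        using C(3) by (rule pointed_zero)
      then have "H \<subseteq> convex hull H + C"
        using set_plus_intro[of _ "convex hull H" 0 C] by (auto intro: hull_inc)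
      then have "convex hull G \<subseteq> convex hull H + C"
        using v C(1) by (intro hull_minimal) (auto simp: GH(1) intro: convex_set_plus)
      then have "convex hull G + C \<subseteq> (convex hull H + C) + C"
        by (rule set_plus_mono2) simp
      also have "\<dots> = convex hull H + (C + C)"
        by (simp add: add.assoc)
      also have "\<dots> \<subseteq> convex hull H + C"
        by (rule set_plus_mono2) (simp_all add: convex_cone_plus_subset C)
      finally have "convex hull G + C \<subseteq> convex hull H + C" .
      moreover have "convex hull H + C \<subseteq> convex hull G + C"
        using GH(1) by (intro set_plus_mono2 hull_mono) auto
      ultimately have "convex hull G + C = convex hull H + C" ..
      then have "H \<in> \<G>"
        using G GH(1) by (auto simp: \<G>_def)
      then show False
        using min[of H] GH by auto
    qed
    then have "v extreme_point_of (convex hull G + C)"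
      unfolding GH(1) by (rule extreme_point_of_hull_insert_plus_cone[OF C])
    then show ?thesis
      using G by (simp add: \<G>_def)
  qed
  moreover have "finite G"
    using G \<open>finite F\<close> by (auto simp: \<G>_def intro: finite_subset)
  ultimately show ?thesis
    using that[of G] G by (auto simp: \<G>_def vert_def)
qed

text \<open>A point \<open>q + c\<close> is the midpoint of \<open>q\<close> and
  \<open>q + 2 *\<^sub>R c\<close>, both in \<open>Q + C\<close>, so extremality forces
  \<open>c = 0\<close>.\<close>

lemma vert_plus_cone_subset:
  assumes "cone C"
  shows "vert (Q + C) \<subseteq> Q"
proof
  fix v assume "v \<in> vert (Q + C)"
  then have v: "v extreme_point_of (Q + C)"
    by (simp add: vert_def)
  then obtain q c where q: "q \<in> Q" and c: "c \<in> C" and eq: "v = q + c"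
    by (auto simp: extreme_point_of_def elim: set_plus_elim)
  have "0 *\<^sub>R c \<in> C" "2 *\<^sub>R c \<in> C"
    using assms c by (auto simp: cone_def simp del: scaleR_zero_left)
  then have "q + 0 \<in> Q + C" "q + 2 *\<^sub>R c \<in> Q + C"
    using q by (auto intro!: set_plus_intro simp del: add_0_right)
  then have "v \<notin> open_segment q (q + 2 *\<^sub>R c)"
    using v by (simp add: extreme_point_of_def)
  moreover have "v = midpoint q (q + 2 *\<^sub>R c)"
    by (simp add: eq midpoint_def scaleR_add_right flip: scaleR_add_left)
  ultimately have "c = 0"
    by simp
  then show "v \<in> Q"
    using q eq by simp
qed

section \<open>Minimization over the vertices\<close>

text \<open>If all values on \<open>G\<close> exceeded \<open>f y\<close>, a level between
  \<open>f y\<close> and their minimum would define a convex superlevel set containing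
  \<open>G\<close> but not \<open>y\<close>. The strict gap always contains a real level, even when
  values are infinite.\<close>

lemma quasi_concave_convex_hull_bound:
  assumes f: "quasi_concave f" and "finite G" and y: "y \<in> convex hull G"
  obtains g where "g \<in> G" "f g \<le> f y"
proof -
  have "\<exists>g\<in>G. f g \<le> f y"
  proof (rule ccontr)
    assume "\<not> (\<exists>g\<in>G. f g \<le> f y)"
    then have less: "f y < f g" if "g \<in> G" for g
      using that by (auto simp: not_le)
    have "G \<noteq> {}"
      using y by auto
    then have "f y < Min (f ` G)"
      using less \<open>finite G\<close> by simp
    then obtain r where r: "f y < ereal r" "ereal r < Min (f ` G)"
      using ereal_dense2 by blast
    then have "G \<subseteq> {y. f y \<ge> ereal r}"
      using \<open>finite G\<close> \<open>G \<noteq> {}\<close> by auto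
    then have "convex hull G \<subseteq> {y. f y \<ge> ereal r}"
      using f by (intro hull_minimal) (auto simp: quasi_concave_def)
    then show False
      using y r(1) by auto
  qed
  then show ?thesis
    using that by blast
qed

theorem corollary6:
  fixes P :: "real ^ 'n ^ 'q"
    and A :: "real ^ 'n ^ 'm"
    and b :: "real ^ 'm"
    and f :: "real ^ 'q \<Rightarrow> ereal"
    and C :: "(real ^ 'q) set"
  assumes "feasible_set A b \<noteq> {}"
    and "quasi_concave f"
    and "polyhedron C" and "convex C" and "cone C" and "pointed C"
    and "cone_monotone_on C (minkowski_diff ((*v) P ` feasible_set A b) C) f"
    and "recession_cone ((*v) P ` feasible_set A b) \<subseteq> C"
  shows "\<exists>x. optimal_solution f P (feasible_set A b) x \<and>
    is_minimum f (vert ((*v) P ` feasible_set A b + C)) (f (P *v x))"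
proof -
  let ?S = "feasible_set A b"
  let ?Q = "(*v) P ` ?S" and ?K = "{d. 0 \<le> A *v d}"
  note C = \<open>convex C\<close> \<open>cone C\<close> \<open>pointed C\<close>
  have "0 \<in> C"
    using C(3) by (rule pointed_zero)
  obtain F where F: "finite F" "F \<subseteq> ?S" "?S \<subseteq> convex hull F + ?K"
    by (rule feasible_set_decomposition)
  \<comment> \<open>Moving along \<open>d\<close> in \<open>?K\<close> preserves feasibility, so its
    image is a recession direction of \<open>?Q\<close> and belongs to \<open>C\<close> by
    assumption.\<close>
  have "(*v) P ` ?K \<subseteq> recession_cone ?Q"
  proof (clarsimp simp: recession_cone_def)
    fix d x and t :: real
    assume "0 \<le> A *v d" "x \<in> ?S" "0 \<le> t"
    then have "x + t *\<^sub>R d \<in> ?S"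
      by (auto simp: feasible_set_def less_eq_vec_def matrix_vector_right_distrib
          matrix_vector_mult_scaleR intro: add_increasing2)
    then show "P *v x + t *\<^sub>R (P *v d) \<in> ?Q"
      by (rule rev_image_eqI) (simp add: matrix_vector_right_distrib matrix_vector_mult_scaleR)
  qed
  then have PK: "(*v) P ` ?K \<subseteq> C"
    using assms(8) by blast
  define F' where "F' = (*v) P ` F"
  have hull_F': "convex hull F' = (*v) P ` (convex hull F)"
    unfolding F'_def by (rule convex_hull_linear_image[symmetric]) simp
  have "convex hull F' \<subseteq> ?Q"
    unfolding hull_F' using F(2) by (intro image_mono hull_minimal convex_feasible_set)
  have "?Q \<subseteq> convex hull F' + C"
  proof
    fix y assume "y \<in> ?Q"
    then obtain h d where "h \<in> convex hull F" "d \<in> ?K" "y = P *v (h + d)"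
      using F(3) by (auto elim!: set_plus_elim dest!: subsetD)
    then show "y \<in> convex hull F' + C"
      using PK by (auto simp: hull_F' matrix_vector_right_distrib intro!: set_plus_intro)
  qed
  then have "?Q + C \<subseteq> (convex hull F' + C) + C"
    by (rule set_plus_mono2) simp
  also have "\<dots> \<subseteq> convex hull F' + C"
    unfolding add.assoc by (rule set_plus_mono2) (simp_all add: convex_cone_plus_subset C)
  finally have "?Q + C \<subseteq> convex hull F' + C" .
  moreover have "convex hull F' + C \<subseteq> ?Q + C"
    using \<open>convex hull F' \<subseteq> ?Q\<close> by (rule set_plus_mono2) simp
  ultimately have QC: "?Q + C = convex hull F' + C" ..
  have "finite F'"
    by (simp add: F'_def F(1))
  then obtain G where G: "finite G" "G \<subseteq> vert (?Q + C)" "?Q + C = convex hull G + C"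
    using convex_hull_plus_cone_vertices[OF _ C, of F'] unfolding QC by blast
  \<comment> \<open>This makes every vertex the image of a feasible point, so a minimizing vertex
    yields a solution \<open>x\<close>.\<close>
  have vert_Q: "vert (?Q + C) \<subseteq> ?Q"
    by (rule vert_plus_cone_subset[OF C(2)])
  have bound: "\<exists>g\<in>G. f g \<le> f y" if y: "y \<in> ?Q" for y
  proof -
    have "y + 0 \<in> convex hull G + C"
      unfolding G(3)[symmetric] using y \<open>0 \<in> C\<close> by (rule set_plus_intro)
    then obtain h c where h: "h \<in> convex hull G" and c: "c \<in> C" and eq: "y = h + c"
      by (auto elim: set_plus_elim)
    \<comment> \<open>These two forms place \<open>h\<close> and \<open>y\<close> in the set on
      which monotonicity is assumed; \<open>h\<close> itself need not lie in
      \<open>?Q\<close>.\<close>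
    have "h = y - c" "y = y - 0"
      by (simp_all add: eq)
    then have "h \<in> minkowski_diff ?Q C" "y \<in> minkowski_diff ?Q C"
      unfolding minkowski_diff_def using y c \<open>0 \<in> C\<close> by blast+
    moreover have "cone_le C h y"
      using c by (simp add: cone_le_def eq)
    ultimately have "f h \<le> f y"
      using assms(7) by (auto simp: cone_monotone_on_def)
    moreover obtain g where "g \<in> G" "f g \<le> f h"
      using quasi_concave_convex_hull_bound[OF assms(2) G(1) h] .
    ultimately show ?thesis
      by (meson order_trans)
  qed
  have "G \<noteq> {}"
    using bound assms(1) by blast
  then obtain v where v: "v \<in> G" "\<And>g. g \<in> G \<Longrightarrow> f v \<le> f g"
    using G(1) by (metis arg_min_if_finite(1) arg_min_least)
  have v_min: "f v \<le> f y" if "y \<in> ?Q" for y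
    using bound[OF that] v(2) by (meson order_trans)
  obtain x where x: "x \<in> ?S" "v = P *v x"
    using v(1) G(2) vert_Q by blast
  have "optimal_solution f P ?S x"
    using x v_min by (auto simp: optimal_solution_def)
  \<comment> \<open>The bound \<open>v_min\<close> holds on \<open>?Q\<close>, hence at all
    vertices, including any outside \<open>G\<close>.\<close>
  moreover have "is_minimum f (vert (?Q + C)) (f (P *v x))"
    unfolding is_minimum_def using v(1) G(2) vert_Q v_min x(2) by blast
  ultimately show ?thesis
    by blast
qed

end
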